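(* Let $X,Y\subseteq\omega$. Then $\mathcal{K}_1^X$ embeds into $\mathcal{K}_1^Y$ if and only if $X\leq_T Y$, in which case $\mathcal{K}_1^X$ embeds into $\mathcal{K}_1^Y$ via a computable embedding.
   Context: For $X\subseteq\omega$, $\mathcal{K}_1^X$ is the pca with underlying set $\omega$ and application $n\cdot m=\Phi_n^X(m)$, where $\Phi_n^X$ is the $n$-th partial $X$-computable function (oracle machine). For pca's $\mathcal{A},\mathcal{B}$, an embedding is an injective map $F:\mathcal{A}\to\mathcal{B}$ such that for all $a,b,c\in\mathcal{A}$: if $a\cdot_\mathcal{A} b$ is defined and equals $c$ then $F(a)\cdot_\mathcal{B}F(b)$ is defined and equals $F(c)$; and if $a\cdot_\mathcal{A}b$ is undefined then $F(a)\cdot_\mathcal{B}F(b)$ is undefined. *)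

theory Defs
  imports Main "HOL-Library.Nat_Bijection"
begin

section \<open>Partial functions computable relative to an oracle\<close>

text \<open>
  Oracle programs are codes for Kleene's partial recursive functions relative to an oracle.
  All functions are unary on the natural numbers; several arguments are passed as one number
  using the bijective Cantor pairing function \<^const>\<open>prod_encode\<close>. (The identity is
  \<open>Pairing Fst Snd\<close>.)
\<close>

datatype code =
    Zero
  | Succ
  | Fst
  | Snd
  | Oracle
  | Pairing code code
  | Comp code code
  | Rec code code
  | Min code

text \<open>
  Unbounded search: it diverges when some \<open>g k\<close> is undefined before the first zero is reached.
\<close>

definition minimize :: "(nat \<rightharpoonup> nat) \<Rightarrow> nat option" where
  "minimize g =
     (if \<exists>n. g n = Some 0 \<and> (\<forall>k<n. \<exists>y. g k = Some (Suc y))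
      then Some (LEAST n. g n = Some 0) else None)"

text \<open>
  \<open>run X c\<close> is the partial function computed by the program \<open>c\<close> with oracle \<open>X\<close>. The value
  \<^const>\<open>None\<close> means that the computation diverges. \<open>Rec f g\<close> is primitive recursion,
  \<open>h(a,0) = f(a)\<close> and \<open>h(a,n+1) = g(a,(n,h(a,n)))\<close>.
\<close>

primrec run :: "nat set \<Rightarrow> code \<Rightarrow> (nat \<rightharpoonup> nat)" where
  "run X Zero = (\<lambda>x. Some 0)"
| "run X Succ = (\<lambda>x. Some (Suc x))"
| "run X Fst = (\<lambda>x. Some (fst (prod_decode x)))"
| "run X Snd = (\<lambda>x. Some (snd (prod_decode x)))"
| "run X Oracle = (\<lambda>x. Some (of_bool (x \<in> X)))"
| "run X (Pairing f g) =
     (\<lambda>x. Option.bind (run X f x) (\<lambda>y.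
          Option.bind (run X g x) (\<lambda>z. Some (prod_encode (y, z)))))"
| "run X (Comp f g) = (\<lambda>x. Option.bind (run X g x) (run X f))"
| "run X (Rec f g) =
     (\<lambda>x. case prod_decode x of (a, n) \<Rightarrow>
        rec_nat (run X f a)
          (\<lambda>k r. Option.bind r (\<lambda>y. run X g (prod_encode (a, prod_encode (k, y))))) n)"
| "run X (Min f) = (\<lambda>x. minimize (\<lambda>n. run X f (prod_encode (x, n))))"

text \<open>
  The Goedel numbering of programs. It does not depend on the oracle, and by \<open>bij_encode\<close>
  every natural number is the number of exactly one program.
\<close>

primrec encode :: "code \<Rightarrow> nat" where
  "encode Zero = 0"
| "encode Succ = 1"
| "encode Fst = 2"
| "encode Snd = 3"
| "encode Oracle = 4"
| "encode (Pairing f g) = 5 + 4 * prod_encode (encode f, encode g)"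
| "encode (Comp f g) = 6 + 4 * prod_encode (encode f, encode g)"
| "encode (Rec f g) = 7 + 4 * prod_encode (encode f, encode g)"
| "encode (Min f) = 8 + 4 * encode f"

lemma encode_inj: "encode c = encode d \<Longrightarrow> c = d"
proof (induction c arbitrary: d)
  case (Pairing f g) then show ?case by (cases d; simp; presburger)
next
  case (Comp f g) then show ?case by (cases d; simp; presburger)
next
  case (Rec f g) then show ?case by (cases d; simp; presburger)
next
  case (Min f) then show ?case by (cases d; simp; presburger)
qed (case_tac d; simp)+

lemma encode_surj: "\<exists>c. encode c = n"
proof (induction n rule: less_induct)
  case (less n)
  show ?case
  proof (cases "n < 5")
    case True
    then consider "n = 0" | "n = 1" | "n = 2" | "n = 3" | "n = 4" by linarith
    then show ?thesis using encode.simps(1-5) by cases metis+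
  next
    case False
    define k where "k = (n - 5) div 4"
    obtain a b where ab: "k = prod_encode (a, b)"
      by (metis prod_decode_inverse surj_pair)
    have "k < n" using False by (simp add: k_def)
    moreover have "a \<le> k" "b \<le> k"
      using ab le_prod_encode_1 le_prod_encode_2 by auto
    ultimately obtain f g h where fgh: "encode f = a" "encode g = b" "encode h = k"
      using less.IH by (meson le_less_trans)
    have "(n - 5) mod 4 < 4" "n - 5 = 4 * k + (n - 5) mod 4" by (simp_all add: k_def)
    then have "n = 5 + 4 * k \<or> n = 6 + 4 * k \<or> n = 7 + 4 * k \<or> n = 8 + 4 * k"
      using False by linarith
    then show ?thesis
      using encode.simps(6-8)[of f g] encode.simps(9)[of h] fgh ab
      by metis
  qed
qed

lemma bij_encode: "bij encode"
  by (meson bijI encode_inj encode_surj injI surjI surj_def)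

text \<open>\<open>\<Phi> X n\<close> is the \<open>n\<close>-th partial \<open>X\<close>-computable function.\<close>

definition \<Phi> :: "nat set \<Rightarrow> nat \<Rightarrow> (nat \<rightharpoonup> nat)" where
  "\<Phi> X n = run X (inv encode n)"

definition computable_in :: "nat set \<Rightarrow> (nat \<Rightarrow> nat) \<Rightarrow> bool" where
  "computable_in X f \<longleftrightarrow> (\<exists>e. \<forall>n. \<Phi> X e n = Some (f n))"

abbreviation computable :: "(nat \<Rightarrow> nat) \<Rightarrow> bool" where
  "computable \<equiv> computable_in {}"

definition turing_le :: "nat set \<Rightarrow> nat set \<Rightarrow> bool"  (infix "\<le>\<^sub>T" 50) where
  "X \<le>\<^sub>T Y \<longleftrightarrow> computable_in Y (\<lambda>n. of_bool (n \<in> X))"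

section \<open>Embeddings of partial combinatory algebras\<close>

text \<open>
  A pca whose underlying set is a whole type is given by its partial application, with
  \<^const>\<open>None\<close> for undefined. Embeddings refer to the application only; no combinators have
  to be preserved.
\<close>

type_synonym 'a papp = "'a \<Rightarrow> 'a \<Rightarrow> 'a option"

definition embedding :: "'a papp \<Rightarrow> 'b papp \<Rightarrow> ('a \<Rightarrow> 'b) \<Rightarrow> bool" where
  "embedding A B F \<longleftrightarrow>
     inj F \<and>
     (\<forall>a b c. A a b = Some c \<longrightarrow> B (F a) (F b) = Some (F c)) \<and>
     (\<forall>a b. A a b = None \<longrightarrow> B (F a) (F b) = None)"

definition embeds :: "'a papp \<Rightarrow> 'b papp \<Rightarrow> bool" where
  "embeds A B \<longleftrightarrow> (\<exists>F. embedding A B F)"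

definition K1 :: "nat set \<Rightarrow> nat papp" where
  "K1 X n m = \<Phi> X n m"

end

theory Submission
  imports Defs
begin

text \<open>
  If \<open>F\<close> is an embedding, then \<open>F (n + 1) = F s \<cdot> F n\<close> for an index \<open>s\<close> of the successor function.
  So \<open>F\<close> is \<open>Y\<close>-computable, although nothing of the kind was assumed, and \<open>n \<in> X\<close> is decided
  by comparing \<open>F e \<cdot> F n\<close> with \<open>F 1\<close>, where \<open>e\<close> is an index of the characteristic function of \<open>X\<close>.

  Conversely, let \<open>d\<close> compute \<open>X\<close> from \<open>Y\<close>. Replacing the oracle calls of a program \<open>c\<close> by \<open>d\<close>
  gives a program that computes with oracle \<open>Y\<close> what \<open>c\<close> computes with oracle \<open>X\<close>; this
  translation acts on program numbers by course-of-values recursion, so no universal machine is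
  needed. The recursion theorem then provides an \<open>F\<close> such that \<open>F a\<close> is the number of a program
  that recovers \<open>b\<close> from \<open>F b\<close>, runs the translation of program \<open>a\<close> on \<open>b\<close>, and applies \<open>F\<close> to
  the result. The number \<open>a\<close> is also stored in \<open>F a\<close> as dead code, whence \<open>F\<close> is injective with
  a computable inverse.
\<close>

section \<open>Total functions computable uniformly in a class of oracles\<close>

text \<open>One program must serve every oracle in \<open>S\<close>: \<open>{Y}\<close> gives
  relative computability, \<open>UNIV\<close> an oracle-independent program.\<close>

definition computes :: "nat set set \<Rightarrow> code \<Rightarrow> (nat \<Rightarrow> nat) \<Rightarrow> bool" where
  "computes S c f \<longleftrightarrow> (\<forall>X\<in>S. \<forall>x. run X c x = Some (f x))"

definition comp_in :: "nat set set \<Rightarrow> (nat \<Rightarrow> nat) \<Rightarrow> bool" where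
  "comp_in S f \<longleftrightarrow> (\<exists>c. computes S c f)"

lemma comp_inI: "computes S c f \<Longrightarrow> comp_in S f"
  by (auto simp: comp_in_def)

lemma \<Phi>_encode [simp]: "\<Phi> X (encode c) = run X c"
  by (simp add: \<Phi>_def bij_is_inj bij_encode)

lemma computable_in_iff_comp_in: "computable_in X f \<longleftrightarrow> comp_in {X} f"
  unfolding computable_in_def comp_in_def computes_def
  by (metis \<Phi>_encode encode_surj singleton_iff)

named_theorems comp_intros

primrec const_code :: "nat \<Rightarrow> code" where
  "const_code 0 = Zero"
| "const_code (Suc n) = Comp Succ (const_code n)"

lemma run_const_code [simp]: "run X (const_code n) x = Some n"
  by (induction n) auto

lemma comp_in_const [comp_intros]: "comp_in S (\<lambda>x. n)"
  by (rule comp_inI[where c = "const_code n"]) (simp add: computes_def)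

lemma comp_in_id [comp_intros]: "comp_in S (\<lambda>x. x)"
  by (rule comp_inI[where c = "Pairing Fst Snd"]) (simp add: computes_def)

lemma comp_in_comp:
  assumes "comp_in S f" "comp_in S g"
  shows "comp_in S (\<lambda>x. f (g x))"
proof -
  obtain c d where "computes S c f" "computes S d g"
    using assms by (auto simp: comp_in_def)
  then show ?thesis
    by (intro comp_inI[where c = "Comp c d"]) (simp add: computes_def)
qed

lemma comp_in_Suc [comp_intros]: "comp_in S f \<Longrightarrow> comp_in S (\<lambda>x. Suc (f x))"
  by (rule comp_in_comp[where f = Suc], rule comp_inI[where c = Succ])
    (simp add: computes_def)

lemma comp_in_fst [comp_intros]: "comp_in S f \<Longrightarrow> comp_in S (\<lambda>x. fst (prod_decode (f x)))"
  by (rule comp_in_comp[where f = "\<lambda>x. fst (prod_decode x)"], rule comp_inI[where c = Fst])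
    (simp add: computes_def)

lemma comp_in_snd [comp_intros]: "comp_in S f \<Longrightarrow> comp_in S (\<lambda>x. snd (prod_decode (f x)))"
  by (rule comp_in_comp[where f = "\<lambda>x. snd (prod_decode x)"], rule comp_inI[where c = Snd])
    (simp add: computes_def)

lemma comp_in_pair [comp_intros]:
  assumes "comp_in S f" "comp_in S g"
  shows "comp_in S (\<lambda>x. prod_encode (f x, g x))"
proof -
  obtain c d where "computes S c f" "computes S d g"
    using assms by (auto simp: comp_in_def)
  then show ?thesis
    by (intro comp_inI[where c = "Pairing c d"]) (simp add: computes_def)
qed

text \<open>The step function \<open>g\<close> takes its three arguments packed as \<^const>\<open>Rec\<close> passes them.\<close>

lemma comp_in_rec_nat [comp_intros]:
  assumes f: "comp_in S f"
    and g: "comp_in S (\<lambda>p. g (fst (prod_decode p)) (fst (prod_decode (snd (prod_decode p))))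
      (snd (prod_decode (snd (prod_decode p)))))"
    and n: "comp_in S n"
  shows "comp_in S (\<lambda>x. rec_nat (f x) (g x) (n x))"
proof -
  obtain c d where c: "computes S c f" and d: "computes S d (\<lambda>p. g (fst (prod_decode p))
      (fst (prod_decode (snd (prod_decode p)))) (snd (prod_decode (snd (prod_decode p)))))"
    using f g by (auto simp: comp_in_def)
  have "run X (Rec c d) (prod_encode (a, m)) = Some (rec_nat (f a) (g a) m)" if "X \<in> S" for X a m
    using that c d by (induction m) (simp_all add: computes_def)
  then have "run X (Rec c d) x
      = Some (rec_nat (f (fst (prod_decode x))) (g (fst (prod_decode x))) (snd (prod_decode x)))"
    if "X \<in> S" for X x
    using that by (metis prod_decode_inverse prod.collapse)
  then have "computes S (Rec c d)
      (\<lambda>x. rec_nat (f (fst (prod_decode x))) (g (fst (prod_decode x))) (snd (prod_decode x)))"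
    unfolding computes_def by blast
  from comp_in_comp[OF comp_inI[OF this] comp_in_pair[OF comp_in_id n]] show ?thesis
    by simp
qed

lemma comp_in_if_zero:
  assumes "comp_in S c" "comp_in S f" "comp_in S g"
  shows "comp_in S (\<lambda>x. if c x = 0 then f x else g x)"
proof -
  have "comp_in S (\<lambda>x. rec_nat (f x) (\<lambda>_ _. g x) (c x))"
    by (intro comp_intros assms comp_in_comp[of S g])
  moreover have "rec_nat (f x) (\<lambda>_ _. g x) (c x) = (if c x = 0 then f x else g x)" for x
    by (cases "c x") auto
  ultimately show ?thesis by simp
qed

lemma comp_in_add [comp_intros]:
  assumes "comp_in S f" "comp_in S g"
  shows "comp_in S (\<lambda>x. f x + g x)"
proof -
  have "comp_in S (\<lambda>x. rec_nat (f x) (\<lambda>_ y. Suc y) (g x))"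
    by (intro comp_intros assms)
  moreover have "rec_nat a (\<lambda>_ y. Suc y) b = a + b" for a b
    by (induction b) auto
  ultimately show ?thesis by simp
qed

lemma comp_in_diff [comp_intros]:
  assumes "comp_in S f" "comp_in S g"
  shows "comp_in S (\<lambda>x. f x - g x)"
proof -
  have pred: "comp_in S (\<lambda>x. h x - 1)" if "comp_in S h" for h
  proof -
    have "comp_in S (\<lambda>x. rec_nat 0 (\<lambda>k _. k) (h x))"
      by (intro comp_intros that)
    moreover have "rec_nat 0 (\<lambda>k _. k) a = a - 1" for a
      by (cases a) auto
    ultimately show ?thesis by simp
  qed
  have "comp_in S (\<lambda>x. rec_nat (f x) (\<lambda>_ y. y - 1) (g x))"
    by (intro comp_intros pred assms)
  moreover have "rec_nat a (\<lambda>_ y. y - 1) b = a - b" for a b :: nat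
    by (induction b) auto
  ultimately show ?thesis by simp
qed

lemma comp_in_if_eq [comp_intros]:
  assumes "comp_in S a" "comp_in S b" "comp_in S f" "comp_in S g"
  shows "comp_in S (\<lambda>x. if a x = b x then f x else g x)"
proof -
  have "comp_in S (\<lambda>x. if (a x - b x) + (b x - a x) = 0 then f x else g x)"
    by (intro comp_in_if_zero comp_intros assms)
  moreover have "(a x - b x) + (b x - a x) = 0 \<longleftrightarrow> a x = b x" for x
    by arith
  ultimately show ?thesis by simp
qed

lemma comp_in_if_less [comp_intros]:
  assumes "comp_in S a" "comp_in S b" "comp_in S f" "comp_in S g"
  shows "comp_in S (\<lambda>x. if a x < b x then f x else g x)"
proof -
  have "comp_in S (\<lambda>x. if Suc (a x) - b x = 0 then f x else g x)"
    by (intro comp_in_if_zero comp_intros assms)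
  moreover have "Suc (a x) - b x = 0 \<longleftrightarrow> a x < b x" for x
    by arith
  ultimately show ?thesis by simp
qed

lemma comp_in_mult4 [comp_intros]:
  assumes "comp_in S f"
  shows "comp_in S (\<lambda>x. 4 * f x)"
proof -
  have "comp_in S (\<lambda>x. f x + f x + (f x + f x))"
    by (intro comp_intros assms)
  moreover have "f x + f x + (f x + f x) = 4 * f x" for x
    by simp
  ultimately show ?thesis by simp
qed

lemma comp_in_mod4 [comp_intros]:
  assumes "comp_in S f"
  shows "comp_in S (\<lambda>x. f x mod 4)"
proof -
  have "comp_in S (\<lambda>x. rec_nat 0 (\<lambda>_ y. if y = 3 then 0 else Suc y) (f x))"
    by (intro comp_intros assms)
  moreover have "rec_nat 0 (\<lambda>_ y. if y = 3 then 0 else Suc y) a = a mod 4" for a :: nat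
    by (induction a) (auto simp: mod_Suc)
  ultimately show ?thesis by simp
qed

lemma comp_in_div4 [comp_intros]:
  assumes "comp_in S f"
  shows "comp_in S (\<lambda>x. f x div 4)"
proof -
  have "comp_in S (\<lambda>x. rec_nat 0 (\<lambda>k y. if k mod 4 = 3 then Suc y else y) (f x))"
    by (intro comp_intros assms)
  moreover have "rec_nat 0 (\<lambda>k y. if k mod 4 = 3 then Suc y else y) a = a div 4" for a :: nat
    by (induction a) (auto simp: div_Suc mod_Suc)
  ultimately show ?thesis by simp
qed

section \<open>Course-of-values recursion\<close>

definition history :: "(nat \<Rightarrow> nat) \<Rightarrow> nat \<Rightarrow> nat" where
  "history f = rec_nat 0 (\<lambda>k h. prod_encode (f k, h))"

text \<open>In a history of length \<open>n\<close> the latest value is outermost, so for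
  \<open>i < n\<close> the value at \<open>i\<close> lies under \<open>n - Suc i\<close>
  others.\<close>

definition lookup :: "nat \<Rightarrow> nat \<Rightarrow> nat \<Rightarrow> nat" where
  "lookup n h i = fst (prod_decode (rec_nat h (\<lambda>_ y. snd (prod_decode y)) (n - Suc i)))"

lemma lookup_history:
  assumes "i < n"
  shows "lookup n (history f n) i = f i"
proof -
  have "rec_nat (history f (m + k)) (\<lambda>_ y. snd (prod_decode y)) k = history f m" for m k
  proof (induction k arbitrary: m)
    case (Suc k)
    from Suc[of "Suc m"] show ?case by (simp add: history_def)
  qed simp
  from this[of "Suc i" "n - Suc i"] show ?thesis
    using assms by (simp add: lookup_def history_def)
qed

lemma comp_in_lookup [comp_intros]:
  assumes "comp_in S n" "comp_in S h" "comp_in S i"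
  shows "comp_in S (\<lambda>x. lookup (n x) (h x) (i x))"
  unfolding lookup_def by (intro comp_intros assms)

text \<open>The histories of \<open>f\<close> satisfy a primitive recursion: each is extended by the
  value that \<open>step\<close> computes from it.\<close>

lemma comp_in_course_of_values:
  assumes f: "\<And>n. f n = step n (history f n)"
    and step: "comp_in S (\<lambda>p. step (fst (prod_decode p)) (snd (prod_decode p)))"
  shows "comp_in S f"
proof -
  have step': "comp_in S (\<lambda>x. step (a x) (b x))" if "comp_in S a" "comp_in S b" for a b
    using comp_in_comp[OF step comp_in_pair[OF that]] by simp
  have "comp_in S (\<lambda>n. rec_nat 0 (\<lambda>k h. prod_encode (step k h, h)) n)"
    by (intro comp_intros step')
  moreover have "rec_nat 0 (\<lambda>k h. prod_encode (step k h, h)) n = history f n" for n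
  proof (induction n)
    case (Suc n)
    then show ?case using f[of n] by (simp add: history_def)
  qed (simp add: history_def)
  ultimately have "comp_in S (history f)" by simp
  then have "comp_in S (\<lambda>n. step n (history f n))"
    by (intro step' comp_in_id)
  then show ?thesis by (simp flip: f)
qed

section \<open>Replacing oracle calls\<close>

primrec subst_oracle :: "code \<Rightarrow> code \<Rightarrow> code" where
  "subst_oracle d Zero = Zero"
| "subst_oracle d Succ = Succ"
| "subst_oracle d Fst = Fst"
| "subst_oracle d Snd = Snd"
| "subst_oracle d Oracle = d"
| "subst_oracle d (Pairing f g) = Pairing (subst_oracle d f) (subst_oracle d g)"
| "subst_oracle d (Comp f g) = Comp (subst_oracle d f) (subst_oracle d g)"
| "subst_oracle d (Rec f g) = Rec (subst_oracle d f) (subst_oracle d g)"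
| "subst_oracle d (Min f) = Min (subst_oracle d f)"

lemma run_subst_oracle:
  assumes "\<And>n. run Y d n = Some (of_bool (n \<in> X))"
  shows "run Y (subst_oracle d c) = run X c"
  by (induction c) (use assms in auto)

definition subst_num :: "code \<Rightarrow> nat \<Rightarrow> nat" where
  "subst_num d n = encode (subst_oracle d (inv encode n))"

lemma subst_num_encode [simp]: "subst_num d (encode c) = encode (subst_oracle d c)"
  by (simp add: subst_num_def bij_is_inj bij_encode)

text \<open>Numbers below 5 are atomic programs, 4 being \<open>Oracle\<close>. Otherwise
  \<open>(n - 5) mod 4\<close> identifies the constructor, 3 being the unary \<open>Min\<close>, and
  \<open>(n - 5) div 4\<close> holds its subprograms.\<close>

definition subst_step :: "code \<Rightarrow> nat \<Rightarrow> nat \<Rightarrow> nat" where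
  "subst_step d n h =
     (if n < 5 then if n = 4 then encode d else n
      else if (n - 5) mod 4 = 3 then 8 + 4 * lookup n h ((n - 5) div 4)
      else 5 + (n - 5) mod 4 +
        4 * prod_encode (lookup n h (fst (prod_decode ((n - 5) div 4))),
                         lookup n h (snd (prod_decode ((n - 5) div 4)))))"

lemma subst_num_rec: "subst_num d n = subst_step d n (history (subst_num d) n)"
proof -
  obtain c where n: "n = encode c"
    using encode_surj by metis
  \<comment> \<open>Subprograms have smaller numbers, so their translations are already in the
    history.\<close>
  have less: "encode f < k + 4 * prod_encode (encode f, encode g)"
    "encode g < k + 4 * prod_encode (encode f, encode g)" if "k > 0" for f g k
    using that le_prod_encode_1[of "encode f" "encode g"] le_prod_encode_2[of "encode g" "encode f"]
    by linarith+
  have arith: "Suc (4 * k) mod 4 = 1" "Suc (4 * k) div 4 = k"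
    "Suc (Suc (4 * k)) mod 4 = 2" "Suc (Suc (4 * k)) div 4 = k"
    "Suc (Suc (Suc (4 * k))) mod 4 = 3" "Suc (Suc (Suc (4 * k))) div 4 = k" for k :: nat
    by presburger+
  show ?thesis
    unfolding n subst_num_encode
    by (cases c) (simp_all add: subst_step_def lookup_history less arith)
qed

lemma comp_in_subst_num: "comp_in S (subst_num d)"
  by (rule comp_in_course_of_values[where step = "subst_step d", OF subst_num_rec])
    (unfold subst_step_def, intro comp_intros)

section \<open>The recursion theorem\<close>

lemma comp_in_encode_const_code: "comp_in S (\<lambda>n. encode (const_code n))"
proof -
  have "comp_in S (\<lambda>n. rec_nat 0 (\<lambda>_ y. 6 + 4 * prod_encode (1, y)) n)"
    by (intro comp_intros)
  moreover have "rec_nat 0 (\<lambda>_ y. 6 + 4 * prod_encode (1, y)) n = encode (const_code n)" for n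
    by (induction n) auto
  ultimately show ?thesis by simp
qed

text \<open>Self-application: if program \<open>u\<close> maps the pair of \<open>u\<close> and
  \<open>x\<close> to \<open>q (diag u) x\<close>, then \<open>diag u\<close> is the number of a
  program for \<open>q (diag u)\<close>.\<close>

lemma recursion_theorem:
  assumes "comp_in S (\<lambda>p. q (fst (prod_decode p)) (snd (prod_decode p)))"
  obtains c where "computes S c (q (encode c))"
proof -
  define i where "i = encode (Pairing Fst Snd)"
  \<comment> \<open>Program \<open>diag u\<close> runs program \<open>u\<close> on the pair of
    \<open>u\<close> and the input.\<close>
  define diag where "diag u = 6 + 4 * prod_encode (u, 5 + 4 * prod_encode (encode (const_code u), i))"
    for u
  have "comp_in S (\<lambda>p. diag (fst (prod_decode p)))"
    unfolding diag_def by (intro comp_intros comp_in_comp[OF comp_in_encode_const_code])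
  then have "comp_in S (\<lambda>p. q (diag (fst (prod_decode p))) (snd (prod_decode p)))"
    using comp_in_comp[OF assms comp_in_pair] comp_in_snd[OF comp_in_id] by fastforce
  then obtain d where
    d: "computes S d (\<lambda>p. q (diag (fst (prod_decode p))) (snd (prod_decode p)))"
    by (auto simp: comp_in_def)
  define c where "c = Comp d (Pairing (const_code (encode d)) (Pairing Fst Snd))"
  have "encode c = diag (encode d)"
    by (simp add: c_def diag_def i_def)
  then have "computes S c (q (encode c))"
    using d by (simp add: computes_def c_def)
  then show ?thesis by (rule that)
qed

section \<open>Embeddings and Turing reducibility\<close>

lemma turing_le_imp_computable_embedding:
  assumes "X \<le>\<^sub>T Y"
  shows "\<exists>F. computable F \<and> embedding (K1 X) (K1 Y) F"
proof -
  obtain d where d: "\<And>n. run Y d n = Some (of_bool (n \<in> X))"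
    using assms unfolding turing_le_def computable_in_iff_comp_in comp_in_def computes_def by auto
  \<comment> \<open>Strips the tags 6 of \<open>Comp\<close> and 7 of \<open>Rec\<close> to reach
    the dead branch, where \<open>F n\<close> stores \<open>n\<close>.\<close>
  define inverse where
    "inverse m = snd (prod_decode ((fst (prod_decode ((m - 6) div 4)) - 7) div 4))" for m
  have "comp_in UNIV inverse"
    unfolding inverse_def by (intro comp_intros)
  then obtain H where H: "\<And>Z m. run Z H m = Some (inverse m)"
    by (auto simp: comp_in_def computes_def)
  \<comment> \<open>\<open>u\<close> stands for the number of a program computing the embedding
    itself.\<close>
  define q where "q u n = 6 + 4 * prod_encode
    (7 + 4 * prod_encode (6 + 4 * prod_encode (u, subst_num d n), n), encode (Pairing H Zero))" for u n
  have "comp_in UNIV (\<lambda>p. q (fst (prod_decode p)) (snd (prod_decode p)))"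
    unfolding q_def by (intro comp_intros comp_in_comp[OF comp_in_subst_num])
  \<comment> \<open>\<open>G\<close> computes the same map with oracle \<open>Y\<close>, as it must
    inside each \<open>F a\<close>, and with the empty oracle, which makes \<open>F\<close>
    computable.\<close>
  then obtain G where G: "computes UNIV G (q (encode G))"
    by (rule recursion_theorem)
  define F where "F = q (encode G)"
  have run_G: "run Z G n = Some (F n)" for Z n
    using G by (simp add: computes_def F_def)
  have inverse_F: "inverse (F n) = n" for n
    by (simp add: inverse_def F_def q_def)
  have F_encode:
    "F (encode c) = encode (Comp (Rec (Comp G (subst_oracle d c)) c) (Pairing H Zero))" for c
    by (simp add: F_def q_def)
  \<comment> \<open>The second component of the argument being 0, the branch \<open>c\<close> of \<^const>\<open>Rec\<close> is never run.\<close>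
  have F_app: "K1 Y (F a) (F b) = map_option F (K1 X a b)" for a b
  proof -
    obtain c where a: "a = encode c"
      using encode_surj by metis
    \<comment> \<open>\<open>H\<close> and \<open>G\<close> are total, so \<open>F a\<close>
      diverges on \<open>F b\<close> exactly when \<open>c\<close> diverges on
      \<open>b\<close>.\<close>
    show ?thesis
      unfolding a K1_def F_encode \<Phi>_encode
      by (cases "run X c b") (simp_all add: H inverse_F run_G run_subst_oracle[OF d])
  qed
  have "inj F"
    using inverse_F by (metis injI)
  then have "embedding (K1 X) (K1 Y) F"
    by (simp add: embedding_def F_app)
  moreover have "computable F"
    unfolding computable_in_iff_comp_in
    by (rule comp_inI[where c = G]) (simp add: computes_def run_G)
  ultimately show ?thesis by blast
qed

lemma embedding_imp_turing_le:
  assumes "embedding (K1 X) (K1 Y) F"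
  shows "X \<le>\<^sub>T Y"
proof -
  have F_app: "\<Phi> Y (F a) (F b) = Some (F c)" if "\<Phi> X a b = Some c" for a b c
    using assms that by (simp add: embedding_def K1_def)
  have "inj F"
    using assms by (simp add: embedding_def)
  obtain s e where s: "F (encode Succ) = encode s" and e: "F (encode Oracle) = encode e"
    using encode_surj by metis
  have run_s: "run Y s (F n) = Some (F (Suc n))" for n
    using F_app[of "encode Succ" n] s by (simp del: encode.simps)
  have run_e: "run Y e (F n) = Some (F (of_bool (n \<in> X)))" for n
    using F_app[of "encode Oracle" n] e by (simp del: encode.simps)
  \<comment> \<open>The parameter 0 is a dummy; \<open>Comp Snd Snd\<close> extracts the previous
    value of \<open>F\<close> from the packed arguments.\<close>
  have rec: "run Y (Rec (const_code (F 0)) (Comp s (Comp Snd Snd))) (prod_encode (0, n)) = Some (F n)"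
    for n
    by (induction n) (simp_all add: run_s)
  have "computes {Y} (Comp e (Comp (Rec (const_code (F 0)) (Comp s (Comp Snd Snd)))
      (Pairing Zero (Pairing Fst Snd)))) (\<lambda>n. F (of_bool (n \<in> X)))"
    using rec by (simp add: computes_def run_e del: run.simps(8))
  then have "comp_in {Y} (\<lambda>n. F (of_bool (n \<in> X)))"
    by (rule comp_inI)
  \<comment> \<open>\<open>F 1\<close> is one fixed number, hence a constant of the program;
    injectivity separates it from \<open>F 0\<close>.\<close>
  then have "comp_in {Y} (\<lambda>n. if F (of_bool (n \<in> X)) = F 1 then 1 else 0)"
    by (intro comp_in_if_eq comp_in_const)
  moreover have "(if F (of_bool (n \<in> X)) = F 1 then 1 else 0) = (of_bool (n \<in> X) :: nat)" for n
    using \<open>inj F\<close> by (simp add: inj_eq)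
  ultimately show ?thesis
    by (simp add: turing_le_def computable_in_iff_comp_in)
qed

theorem theorem8p4:
  fixes X Y :: "nat set"
  shows "(embeds (K1 X) (K1 Y) \<longleftrightarrow> X \<le>\<^sub>T Y) \<and>
    (X \<le>\<^sub>T Y \<longrightarrow> (\<exists>F. computable F \<and> embedding (K1 X) (K1 Y) F))"
  using turing_le_imp_computable_embedding embedding_imp_turing_le
  unfolding embeds_def by blast

end
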